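(* Let $\Bbbk$ be an algebraically closed field of characteristic $p>0$, $G$ a linear algebraic group over $\Bbbk$, $V$ a $G$-module and $H$ a subgroup of $G$. Then $\delta(G,V)\ge \epsilon(H,V)$ if $V^G\setminus\mathcal{N}_{G,V}\ne\emptyset$, and $\sigma(G,V)\ge\tau(H,V)$ if $V\setminus\mathcal{N}_{G,V}\neq\emptyset$.
   Context: A $G$-module is a finite-dimensional rational representation $V$ of $G$ over $\Bbbk$. $\Bbbk[V]\cong S(V^* )$ is the ring of polynomial functions on $V$, with $G$-action $(g\cdot f)(v)=f(g^{-1}v)$ and invariant ring $\Bbbk[V]^G$, graded by degree; $\Bbbk[V]^G_d$ is the set of homogeneous invariants of degree $d$ together with $0$, and $\Bbbk[V]^G_{\le d}$ the set of invariants of degree at most $d$. For $S\subseteq \Bbbk[V]$, $S_+$ is the set of elements of $S$ with constant term zero. The nullcone $\mathcal{N}_{G,V}\subseteq V$ is the common zero set of $\Bbbk[V]^G_+$. The same notation is used with a subgroup $H$ in place of $G$. A subset $S\subseteq\Bbbk[V]^G$ is a $\delta$-set (resp. $\sigma$-set) if for every $v\in V^G\setminus\mathcal{N}_{G,V}$ (resp. $v\in V\setminus\mathcal{N}_{G,V}$) there is $f\in S_+$ with $f(v)\neq 0$. Then $\delta(G,V)$ (resp. $\sigma(G,V)$) is the minimal $d\ge0$ such that $\Bbbk[V]^G_{\le d}$ is a $\delta$-set (resp. $\sigma$-set). For a group $H$ acting on $V$ and $v\in V$, put $\epsilon(H,v)=\inf\{d\in\mathbb{N}_{>0} : \text{there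 exists } f\in\Bbbk[V]^H_d \text{ with } f(v)\ne0\}$, where the infimum of the empty set is $\infty$. Put $\epsilon(H,V)=\inf\{\epsilon(H,v): v\in V^H\setminus\mathcal{N}_{H,V}\}$ and $\tau(H,V)=\inf\{\epsilon(H,v): v\in V\setminus\mathcal{N}_{H,V}\}$. *)

theory Defs
  imports
    "HOL-Analysis.Analysis"
    "HOL-Algebra.Group"
    "HOL-Computational_Algebra.Polynomial"
    "HOL-Library.Extended_Nat"
begin

section \<open>Polynomial functions\<close>

inductive_set function_algebra :: "('a \<Rightarrow> 'k::field) set \<Rightarrow> ('a \<Rightarrow> 'k) set"
  for L :: "('a \<Rightarrow> 'k) set" where
  const: "(\<lambda>_. c) \<in> function_algebra L"
| gen: "l \<in> L \<Longrightarrow> l \<in> function_algebra L"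
| add: "f \<in> function_algebra L \<Longrightarrow> g \<in> function_algebra L \<Longrightarrow> (\<lambda>x. f x + g x) \<in> function_algebra L"
| mult: "f \<in> function_algebra L \<Longrightarrow> g \<in> function_algebra L \<Longrightarrow> (\<lambda>x. f x * g x) \<in> function_algebra L"

definition dual_space :: "('k::field \<Rightarrow> 'v::ab_group_add \<Rightarrow> 'v) \<Rightarrow> ('v \<Rightarrow> 'k) set" where
  "dual_space scl = {l. Vector_Spaces.linear scl (*) l}"

text \<open>
  Throughout, the vector space \<open>V\<close> is a whole type \<open>'v\<close> with scalar multiplication \<open>scl\<close>.
  The ground field is infinite wherever these notions are used, so polynomials on \<open>V\<close>, i.e. elements
  of the symmetric algebra of the dual space, are identified with the functions they induce.
\<close>

definition poly_ring :: "('k::field \<Rightarrow> 'v::ab_group_add \<Rightarrow> 'v) \<Rightarrow> ('v \<Rightarrow> 'k) set" where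
  "poly_ring scl = function_algebra (dual_space scl)"

text \<open>
  The homogeneous polynomial functions of degree \<open>d\<close> (including \<open>0\<close>): sums of products of \<open>d\<close> linear
  forms. Scalar multiples are covered because linear forms and constants are closed under them.
\<close>

inductive_set homogeneous :: "('k::field \<Rightarrow> 'v::ab_group_add \<Rightarrow> 'v) \<Rightarrow> nat \<Rightarrow> ('v \<Rightarrow> 'k) set"
  for scl :: "'k \<Rightarrow> 'v \<Rightarrow> 'v" and d :: nat where
  prod: "(\<And>i. i < d \<Longrightarrow> l i \<in> dual_space scl) \<Longrightarrow> (\<lambda>v. c * (\<Prod>i<d. l i v)) \<in> homogeneous scl d"
| add: "f \<in> homogeneous scl d \<Longrightarrow> g \<in> homogeneous scl d \<Longrightarrow> (\<lambda>v. f v + g v) \<in> homogeneous scl d"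

definition degree_le :: "('k::field \<Rightarrow> 'v::ab_group_add \<Rightarrow> 'v) \<Rightarrow> nat \<Rightarrow> ('v \<Rightarrow> 'k) set" where
  "degree_le scl d = {\<lambda>v. \<Sum>i\<le>d. h i v | h. \<forall>i\<le>d. h i \<in> homogeneous scl i}"

text \<open>The constant term of a polynomial function is its value at the origin.\<close>

definition plus_part :: "('v::ab_group_add \<Rightarrow> 'k::field) set \<Rightarrow> ('v \<Rightarrow> 'k) set" where
  "plus_part S = {f \<in> S. f 0 = 0}"


section \<open>Linear algebraic groups and their modules\<close>

definition coordinates :: "('k::field ^ 'n \<Rightarrow> 'k) set" where
  "coordinates = range (\<lambda>i x. x $ i)"

definition coordinates2 :: "(('k::field ^ 'n) \<times> ('k ^ 'n) \<Rightarrow> 'k) set" where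
  "coordinates2 = range (\<lambda>i (x, y). x $ i) \<union> range (\<lambda>i (x, y). y $ i)"

definition zariski_closed :: "('k::field ^ 'n) set \<Rightarrow> bool" where
  "zariski_closed X \<longleftrightarrow> (\<exists>P \<subseteq> function_algebra coordinates. X = {x. \<forall>f\<in>P. f x = 0})"

text \<open>
  An affine variety (a Zariski closed subset of some affine space) with a group structure whose
  multiplication and inversion are morphisms, i.e. are given by polynomials in the coordinates.
  For example, \<open>GL\<^sub>m\<close> is realised by the pairs \<open>(A, t)\<close> with \<open>t * det A = 1\<close>.
\<close>

locale linear_algebraic_group = group G
  for G :: "('k::alg_closed_field ^ 'n, 'b) monoid_scheme" (structure) +
  assumes closed: "zariski_closed (carrier G)"
    and mult_morphism:
      "\<exists>f \<in> function_algebra coordinates2.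
         \<forall>x\<in>carrier G. \<forall>y\<in>carrier G. (x \<otimes> y) $ i = f (x, y)"
    and inv_morphism:
      "\<exists>f \<in> function_algebra coordinates. \<forall>x\<in>carrier G. (inv x) $ i = f x"

text \<open>
  A finite-dimensional rational representation: a homomorphism to \<open>GL(V)\<close> all of whose matrix
  coefficients are regular functions on \<open>G\<close>. Invertibility of the \<open>\<rho> g\<close> follows from the group laws.
\<close>

locale rational_module =
  G: linear_algebraic_group G +
  V: finite_dimensional_vector_space scl B
  for G :: "('k::alg_closed_field ^ 'n, 'b) monoid_scheme" (structure)
    and scl :: "'k \<Rightarrow> 'v::ab_group_add \<Rightarrow> 'v"
    and B :: "'v set" +
  fixes \<rho> :: "'k ^ 'n \<Rightarrow> 'v \<Rightarrow> 'v"
  assumes rep_linear: "g \<in> carrier G \<Longrightarrow> Vector_Spaces.linear scl scl (\<rho> g)"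
    and rep_one: "\<rho> \<one> v = v"
    and rep_mult: "g \<in> carrier G \<Longrightarrow> h \<in> carrier G \<Longrightarrow> \<rho> (g \<otimes> h) v = \<rho> g (\<rho> h v)"
    and rep_regular: "l \<in> dual_space scl \<Longrightarrow>
      \<exists>f \<in> function_algebra coordinates. \<forall>g\<in>carrier G. l (\<rho> g v) = f g"


section \<open>Invariants, the nullcone, and the numbers attached to them\<close>

text \<open>
  The notions below depend on an abstract group \<open>G\<close> acting on \<open>V\<close> through \<open>\<rho>\<close>; for a subgroup
  \<open>H\<close> they are used with \<open>G\<lparr>carrier := H\<rparr>\<close>.
\<close>

definition fun_action ::
  "('g, 'b) monoid_scheme \<Rightarrow> ('g \<Rightarrow> 'v \<Rightarrow> 'v) \<Rightarrow> 'g \<Rightarrow> ('v \<Rightarrow> 'k) \<Rightarrow> 'v \<Rightarrow> 'k" where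
  "fun_action G \<rho> g f = (\<lambda>v. f (\<rho> (inv\<^bsub>G\<^esub> g) v))"

definition fixed_points :: "('g, 'b) monoid_scheme \<Rightarrow> ('g \<Rightarrow> 'v \<Rightarrow> 'v) \<Rightarrow> 'v set" where
  "fixed_points G \<rho> = {v. \<forall>g\<in>carrier G. \<rho> g v = v}"

definition invariants ::
  "('g, 'b) monoid_scheme \<Rightarrow> ('k::field \<Rightarrow> 'v::ab_group_add \<Rightarrow> 'v) \<Rightarrow> ('g \<Rightarrow> 'v \<Rightarrow> 'v) \<Rightarrow> ('v \<Rightarrow> 'k) set" where
  "invariants G scl \<rho> = {f \<in> poly_ring scl. \<forall>g\<in>carrier G. fun_action G \<rho> g f = f}"

definition nullcone ::
  "('g, 'b) monoid_scheme \<Rightarrow> ('k::field \<Rightarrow> 'v::ab_group_add \<Rightarrow> 'v) \<Rightarrow> ('g \<Rightarrow> 'v \<Rightarrow> 'v) \<Rightarrow> 'v set" where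
  "nullcone G scl \<rho> = {v. \<forall>f \<in> plus_part (invariants G scl \<rho>). f v = 0}"

definition delta_set ::
  "('g, 'b) monoid_scheme \<Rightarrow> ('k::field \<Rightarrow> 'v::ab_group_add \<Rightarrow> 'v) \<Rightarrow> ('g \<Rightarrow> 'v \<Rightarrow> 'v) \<Rightarrow> ('v \<Rightarrow> 'k) set \<Rightarrow> bool" where
  "delta_set G scl \<rho> S \<longleftrightarrow> S \<subseteq> invariants G scl \<rho> \<and>
     (\<forall>v \<in> fixed_points G \<rho> - nullcone G scl \<rho>. \<exists>f \<in> plus_part S. f v \<noteq> 0)"

definition sigma_set ::
  "('g, 'b) monoid_scheme \<Rightarrow> ('k::field \<Rightarrow> 'v::ab_group_add \<Rightarrow> 'v) \<Rightarrow> ('g \<Rightarrow> 'v \<Rightarrow> 'v) \<Rightarrow> ('v \<Rightarrow> 'k) set \<Rightarrow> bool" where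
  "sigma_set G scl \<rho> S \<longleftrightarrow> S \<subseteq> invariants G scl \<rho> \<and>
     (\<forall>v \<in> UNIV - nullcone G scl \<rho>. \<exists>f \<in> plus_part S. f v \<noteq> 0)"

text \<open>
  For a rational module the infima defining \<open>delta\<close> and \<open>sigma\<close> are minima of nonempty sets of
  natural numbers, since finitely many invariants already cut out the nullcone.
\<close>

definition delta ::
  "('g, 'b) monoid_scheme \<Rightarrow> ('k::field \<Rightarrow> 'v::ab_group_add \<Rightarrow> 'v) \<Rightarrow> ('g \<Rightarrow> 'v \<Rightarrow> 'v) \<Rightarrow> enat" where
  "delta G scl \<rho> =
     Inf {enat d | d. delta_set G scl \<rho> (invariants G scl \<rho> \<inter> degree_le scl d)}"

definition sigma ::
  "('g, 'b) monoid_scheme \<Rightarrow> ('k::field \<Rightarrow> 'v::ab_group_add \<Rightarrow> 'v) \<Rightarrow> ('g \<Rightarrow> 'v \<Rightarrow> 'v) \<Rightarrow> enat" where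
  "sigma G scl \<rho> =
     Inf {enat d | d. sigma_set G scl \<rho> (invariants G scl \<rho> \<inter> degree_le scl d)}"

definition epsilon_at ::
  "('g, 'b) monoid_scheme \<Rightarrow> ('k::field \<Rightarrow> 'v::ab_group_add \<Rightarrow> 'v) \<Rightarrow> ('g \<Rightarrow> 'v \<Rightarrow> 'v) \<Rightarrow> 'v \<Rightarrow> enat" where
  "epsilon_at H scl \<rho> v =
     Inf {enat d | d. d > 0 \<and> (\<exists>f \<in> invariants H scl \<rho> \<inter> homogeneous scl d. f v \<noteq> 0)}"

definition epsilon ::
  "('g, 'b) monoid_scheme \<Rightarrow> ('k::field \<Rightarrow> 'v::ab_group_add \<Rightarrow> 'v) \<Rightarrow> ('g \<Rightarrow> 'v \<Rightarrow> 'v) \<Rightarrow> enat" where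
  "epsilon H scl \<rho> = (INF v \<in> fixed_points H \<rho> - nullcone H scl \<rho>. epsilon_at H scl \<rho> v)"

definition tau ::
  "('g, 'b) monoid_scheme \<Rightarrow> ('k::field \<Rightarrow> 'v::ab_group_add \<Rightarrow> 'v) \<Rightarrow> ('g \<Rightarrow> 'v \<Rightarrow> 'v) \<Rightarrow> enat" where
  "tau H scl \<rho> = (INF v \<in> UNIV - nullcone H scl \<rho>. epsilon_at H scl \<rho> v)"

end

theory Submission
  imports Defs
begin

text \<open>
  The homogeneous components of an invariant are invariant, because the action is linear and the
  ground field is infinite. So if an invariant of degree at most \<open>d\<close> without constant term does not
  vanish at \<open>v\<close>, then some homogeneous \<open>G\<close>-invariant of positive degree at most \<open>d\<close> does not vanish
  at \<open>v\<close>. It is also \<open>H\<close>-invariant, hence \<open>v\<close> lies outside the nullcone of \<open>H\<close> and the degree bounds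
  \<open>\<epsilon>(H, v)\<close> from above.
\<close>

lemma infinite_UNIV_alg_closed_field: "infinite (UNIV :: 'k::alg_closed_field set)"
proof
  assume fin: "finite (UNIV :: 'k set)"
  define q :: "'k poly" where "q = (\<Prod>a\<in>UNIV. [:-a, 1:])"
  have "degree q = card (UNIV :: 'k set)"
    unfolding q_def by (subst degree_prod_eq_sum_degree) auto
  then have "degree (q + 1) > 0"
    using fin by (subst degree_add_eq_left) (auto simp: card_gt_0_iff)
  then obtain x where "poly (q + 1) x = 0"
    using alg_closed_imp_poly_has_root by blast
  moreover have "poly q x = 0"
    using fin by (auto simp: q_def poly_prod)
  ultimately show False by simp
qed

lemma poly_fun_coeffs_unique:
  fixes a b :: "nat \<Rightarrow> 'k::idom"
  assumes inf: "infinite (UNIV :: 'k set)"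
    and eq: "\<And>t. (\<Sum>i\<le>d. a i * t ^ i) = (\<Sum>i\<le>d. b i * t ^ i)"
    and "i \<le> d"
  shows "a i = b i"
proof -
  define q where "q = (\<Sum>i\<le>d. monom (a i - b i) i)"
  have "poly q t = 0" for t
    using eq[of t] by (simp add: q_def poly_sum poly_monom left_diff_distrib sum_subtractf)
  then have "q = 0"
    using inf poly_roots_finite[of q] by auto
  moreover have "coeff q i = a i - b i"
    using \<open>i \<le> d\<close> by (simp add: q_def coeff_sum)
  ultimately show ?thesis by simp
qed

lemma homogeneous_scale:
  assumes "h \<in> homogeneous scl d"
  shows "h (scl t v) = t ^ d * h v"
  using assms
proof induction
  case (prod l c)
  have "l i (scl t v) = t * l i v" if "i < d" for i
    using prod[OF that] unfolding dual_space_def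
    by (auto simp: Vector_Spaces.linear_iff)
  then have "(\<Prod>i<d. l i (scl t v)) = (\<Prod>i<d. t * l i v)"
    by (intro prod.cong) auto
  then show ?case
    by (simp add: prod.distrib)
next
  case (add f g)
  then show ?case by (simp add: distrib_left)
qed

lemma homogeneous_zero:
  assumes "vector_space scl" and "h \<in> homogeneous scl d" and "d > 0"
  shows "h 0 = 0"
proof -
  interpret vector_space scl by fact
  show ?thesis
    using homogeneous_scale[OF assms(2), of 0 0] \<open>d > 0\<close> by (simp add: zero_power)
qed

lemma homogeneous_degree_0_const:
  assumes "h \<in> homogeneous scl 0"
  shows "h v = h w"
  using assms by induction auto

lemma homogeneous_subset_poly_ring:
  fixes scl :: "'k::field \<Rightarrow> 'v::ab_group_add \<Rightarrow> 'v"
  shows "homogeneous scl d \<subseteq> poly_ring scl"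
proof
  have prods: "(\<lambda>v. \<Prod>i<n. l i v) \<in> poly_ring scl"
    if "\<And>i. i < n \<Longrightarrow> l i \<in> dual_space scl" for n and l :: "nat \<Rightarrow> 'v \<Rightarrow> 'k"
    using that unfolding poly_ring_def
    by (induction n)
      (auto intro!: function_algebra.mult intro: function_algebra.const function_algebra.gen)
  fix h assume "h \<in> homogeneous scl d"
  then show "h \<in> poly_ring scl"
  proof induction
    case (prod l c)
    then show ?case
      using prods[of d l] unfolding poly_ring_def
      by (auto intro!: function_algebra.mult function_algebra.const)
  next
    case (add f g)
    then show ?case
      unfolding poly_ring_def by (auto intro: function_algebra.add)
  qed
qed

lemma homogeneous_component_invariant:
  fixes scl :: "'k::field \<Rightarrow> 'v::ab_group_add \<Rightarrow> 'v"
  assumes inf: "infinite (UNIV :: 'k set)"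
    and lin: "\<And>g. g \<in> carrier G \<Longrightarrow> Vector_Spaces.linear scl scl (\<rho> (inv\<^bsub>G\<^esub> g))"
    and hom: "\<And>i. i \<le> d \<Longrightarrow> h i \<in> homogeneous scl i"
    and inv: "(\<lambda>v. \<Sum>i\<le>d. h i v) \<in> invariants G scl \<rho>"
    and "i \<le> d"
  shows "h i \<in> invariants G scl \<rho>"
proof -
  have "h i (\<rho> (inv\<^bsub>G\<^esub> g) v) = h i v" if g: "g \<in> carrier G" for g v
  proof (rule poly_fun_coeffs_unique[OF inf _ \<open>i \<le> d\<close>])
    fix t
    have "(\<Sum>i\<le>d. h i (\<rho> (inv\<^bsub>G\<^esub> g) w)) = (\<Sum>i\<le>d. h i w)" for w
      using inv g unfolding invariants_def fun_action_def by (auto dest!: bspec fun_cong)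
    from this[of "scl t v"]
    have "(\<Sum>i\<le>d. h i (scl t (\<rho> (inv\<^bsub>G\<^esub> g) v))) = (\<Sum>i\<le>d. h i (scl t v))"
      using lin[OF g] by (simp add: Vector_Spaces.linear_iff)
    then show "(\<Sum>i\<le>d. h i (\<rho> (inv\<^bsub>G\<^esub> g) v) * t ^ i) = (\<Sum>i\<le>d. h i v * t ^ i)"
      using homogeneous_scale[OF hom] by (simp add: mult.commute)
  qed
  then show ?thesis
    using hom[OF \<open>i \<le> d\<close>] homogeneous_subset_poly_ring
    unfolding invariants_def fun_action_def by fastforce
qed

lemma (in group) invariants_subgroup:
  assumes "subgroup H G"
  shows "invariants G scl \<rho> \<subseteq> invariants (G\<lparr>carrier := H\<rparr>) scl \<rho>"
  using subgroup.subset[OF assms] m_inv_consistent[OF assms]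
  by (fastforce simp: invariants_def fun_action_def)

lemma epsilon_at_subgroup_le:
  assumes mod: "rational_module G scl B \<rho>" and H: "subgroup H G"
    and f: "f \<in> plus_part (invariants G scl \<rho> \<inter> degree_le scl d)" and "f v \<noteq> 0"
  shows "v \<notin> nullcone (G\<lparr>carrier := H\<rparr>) scl \<rho>"
    and "epsilon_at (G\<lparr>carrier := H\<rparr>) scl \<rho> v \<le> enat d"
proof -
  interpret rational_module G scl B \<rho> by fact
  from f obtain h where h: "\<And>i. i \<le> d \<Longrightarrow> h i \<in> homogeneous scl i"
    and f_eq: "f = (\<lambda>v. \<Sum>i\<le>d. h i v)" and inv: "f \<in> invariants G scl \<rho>" and "f 0 = 0"
    unfolding plus_part_def degree_le_def by auto
  have pos: "h i 0 = 0" if "i \<le> d" "i > 0" for i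
    using homogeneous_zero[OF V.vector_space_axioms h] that by blast
  have "f 0 = (\<Sum>i\<in>{0}. h i 0)"
    unfolding f_eq by (rule sum.mono_neutral_right) (auto intro: pos)
  with \<open>f 0 = 0\<close> have "h 0 v = 0"
    using homogeneous_degree_0_const[OF h, of v 0] by simp
  obtain i where i: "i \<le> d" "h i v \<noteq> 0"
    using \<open>f v \<noteq> 0\<close> unfolding f_eq by (metis atMost_iff sum.neutral)
  with \<open>h 0 v = 0\<close> have "i > 0" by (metis gr0I)
  have "h i \<in> invariants G scl \<rho>"
    using rep_linear inv unfolding f_eq
    by (intro homogeneous_component_invariant[OF infinite_UNIV_alg_closed_field _ h _ i(1)]) auto
  then have hH: "h i \<in> invariants (G\<lparr>carrier := H\<rparr>) scl \<rho>"
    using G.invariants_subgroup[OF H] by blast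
  show "v \<notin> nullcone (G\<lparr>carrier := H\<rparr>) scl \<rho>"
    using hH pos[OF i(1) \<open>i > 0\<close>] i(2) unfolding nullcone_def plus_part_def by auto
  have "epsilon_at (G\<lparr>carrier := H\<rparr>) scl \<rho> v \<le> enat i"
    unfolding epsilon_at_def using hH h[OF i(1)] i(2) \<open>i > 0\<close> by (intro Inf_lower) blast
  with i(1) show "epsilon_at (G\<lparr>carrier := H\<rparr>) scl \<rho> v \<le> enat d"
    by (meson enat_ord_simps(1) order_trans)
qed

theorem lemma3p1:
  fixes G :: "('k::alg_closed_field ^ 'n, 'b) monoid_scheme"
    and scl :: "'k \<Rightarrow> 'v::ab_group_add \<Rightarrow> 'v"
    and B :: "'v set"
    and \<rho> :: "'k ^ 'n \<Rightarrow> 'v \<Rightarrow> 'v"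
    and H :: "('k ^ 'n) set"
    and p :: nat
  assumes "CHAR('k) = p" and "p > 0"
    and "rational_module G scl B \<rho>"
    and "subgroup H G"
  shows "(fixed_points G \<rho> - nullcone G scl \<rho> \<noteq> {} \<longrightarrow>
            delta G scl \<rho> \<ge> epsilon (G\<lparr>carrier := H\<rparr>) scl \<rho>) \<and>
         (UNIV - nullcone G scl \<rho> \<noteq> {} \<longrightarrow>
            sigma G scl \<rho> \<ge> tau (G\<lparr>carrier := H\<rparr>) scl \<rho>)"
proof (intro conjI impI)
  let ?H = "G\<lparr>carrier := H\<rparr>"
  note bound = epsilon_at_subgroup_le[OF assms(3,4)]
  {
    assume "fixed_points G \<rho> - nullcone G scl \<rho> \<noteq> {}"
    then obtain v where v: "v \<in> fixed_points G \<rho> - nullcone G scl \<rho>" by blast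
    have fix_H: "v \<in> fixed_points ?H \<rho>"
      using v subgroup.subset[OF assms(4)] by (auto simp: fixed_points_def)
    show "epsilon ?H scl \<rho> \<le> delta G scl \<rho>"
      unfolding delta_def
    proof (rule Inf_greatest, clarify)
      fix d assume "delta_set G scl \<rho> (invariants G scl \<rho> \<inter> degree_le scl d)"
      then obtain f where f: "f \<in> plus_part (invariants G scl \<rho> \<inter> degree_le scl d)" "f v \<noteq> 0"
        using v unfolding delta_set_def by blast
      have "epsilon ?H scl \<rho> \<le> epsilon_at ?H scl \<rho> v"
        unfolding epsilon_def using fix_H bound(1)[OF f] by (intro INF_lower) blast
      also note bound(2)[OF f]
      finally show "epsilon ?H scl \<rho> \<le> enat d" .
    qed
  next
    assume "UNIV - nullcone G scl \<rho> \<noteq> {}"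
    then obtain v where v: "v \<in> UNIV - nullcone G scl \<rho>" by blast
    show "tau ?H scl \<rho> \<le> sigma G scl \<rho>"
      unfolding sigma_def
    proof (rule Inf_greatest, clarify)
      fix d assume "sigma_set G scl \<rho> (invariants G scl \<rho> \<inter> degree_le scl d)"
      then obtain f where f: "f \<in> plus_part (invariants G scl \<rho> \<inter> degree_le scl d)" "f v \<noteq> 0"
        using v unfolding sigma_set_def by blast
      have "tau ?H scl \<rho> \<le> epsilon_at ?H scl \<rho> v"
        unfolding tau_def using bound(1)[OF f] by (intro INF_lower) blast
      also note bound(2)[OF f]
      finally show "tau ?H scl \<rho> \<le> enat d" .
    qed
  }
qed

end
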